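(* Let $P$ be an interval order with no infinite antichains such that the incomparability graph $\mathrm{Inc}(P)$ is connected and has infinite diameter. Then $\mathrm{Inc}(P)$ has an infinite isometric path.
   Context: A poset $P$ is an interval order if it is isomorphic to a set of non-empty intervals of some chain $C$, ordered by: $I<J$ iff $x<y$ for every $x\in I$ and every $y\in J$. The incomparability graph $\mathrm{Inc}(P)$ of $P=(V,\le)$ has vertex set $V$ and edges the pairs of incomparable elements. For a graph $G$, $d_G(x,y)$ is the length of a shortest path joining $x$ and $y$ ($\infty$ if none); the diameter of $G$ is $\sup\{d_G(x,y):x,y\in V(G)\}$. An infinite isometric path of $G$ is a sequence $(x_n)_{n\in\mathbb N}$ of vertices with $d_G(x_i,x_j)=|i-j|$ for all $i,j\in\mathbb N$. *)

theory Defs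
  imports "Graph_Theory.Graph_Theory" "HOL-Library.Extended_Nat"
begin

section \<open>Interval orders\<close>

text \<open>Posets and chains are carrier sets with a reflexive order relation, as in
  \<^const>\<open>partial_order_on\<close> and \<^const>\<open>linear_order_on\<close>. Intervals are the order-convex
  subsets; they need not have endpoints.\<close>

definition interval_of_chain :: "'c set \<Rightarrow> 'c rel \<Rightarrow> 'c set \<Rightarrow> bool" where
  "interval_of_chain C s I \<longleftrightarrow>
     I \<subseteq> C \<and> (\<forall>x\<in>I. \<forall>y\<in>I. \<forall>z\<in>C. (x, z) \<in> s \<and> (z, y) \<in> s \<longrightarrow> z \<in> I)"

definition interval_less :: "'c rel \<Rightarrow> 'c set \<Rightarrow> 'c set \<Rightarrow> bool" where
  "interval_less s I J \<longleftrightarrow> (\<forall>x\<in>I. \<forall>y\<in>J. (x, y) \<in> s \<and> x \<noteq> y)"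

definition interval_le_rel :: "'c rel \<Rightarrow> 'c set set \<Rightarrow> 'c set rel" where
  "interval_le_rel s \<J> = {(I, J). I \<in> \<J> \<and> J \<in> \<J> \<and> (I = J \<or> interval_less s I J)}"

definition order_isomorphism :: "'a set \<Rightarrow> 'a rel \<Rightarrow> 'b set \<Rightarrow> 'b rel \<Rightarrow> ('a \<Rightarrow> 'b) \<Rightarrow> bool" where
  "order_isomorphism A r B s h \<longleftrightarrow>
     bij_betw h A B \<and> (\<forall>x\<in>A. \<forall>y\<in>A. (x, y) \<in> r \<longleftrightarrow> (h x, h y) \<in> s)"

text \<open>HOL cannot quantify existentially over the type of the elements of the chain, so this
  type is a parameter. If it is a type variable in a hypothesis of a theorem, the theorem
  covers chains of every type.\<close>

definition interval_order :: "'c itself \<Rightarrow> 'a set \<Rightarrow> 'a rel \<Rightarrow> bool" where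
  "interval_order (_ :: 'c itself) V r \<longleftrightarrow>
     partial_order_on V r \<and>
     (\<exists>(C :: 'c set) s \<J> h. linear_order_on C s \<and>
        (\<forall>I\<in>\<J>. I \<noteq> {} \<and> interval_of_chain C s I) \<and>
        order_isomorphism V r \<J> (interval_le_rel s \<J>) h)"

definition antichain_of :: "'a set \<Rightarrow> 'a rel \<Rightarrow> 'a set \<Rightarrow> bool" where
  "antichain_of V r A \<longleftrightarrow> A \<subseteq> V \<and> (\<forall>x\<in>A. \<forall>y\<in>A. x \<noteq> y \<longrightarrow> (x, y) \<notin> r)"


section \<open>Incomparability graphs\<close>

text \<open>An undirected edge is represented by its two opposite arcs.\<close>

definition incomparability_graph :: "'a set \<Rightarrow> 'a rel \<Rightarrow> ('a, 'a \<times> 'a) pre_digraph" where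
  "incomparability_graph V r = with_proj
     \<lparr> pverts = V,
       parcs = {(x, y). x \<in> V \<and> y \<in> V \<and> (x, y) \<notin> r \<and> (y, x) \<notin> r} \<rparr>"

lemma verts_incomparability_graph [simp]: "verts (incomparability_graph V r) = V"
  by (simp add: incomparability_graph_def)

lemma dominates_incomparability_graph_iff:
  "x \<rightarrow>\<^bsub>incomparability_graph V r\<^esub> y \<longleftrightarrow>
     x \<in> V \<and> y \<in> V \<and> (x, y) \<notin> r \<and> (y, x) \<notin> r"
  by (simp add: incomparability_graph_def)

lemma sym_digraph_incomparability_graph: "sym_digraph (incomparability_graph V r)"
  by unfold_locales (auto simp: incomparability_graph_def symmetric_def sym_def)

lemma loopfree_digraph_incomparability_graph:
  assumes "partial_order_on V r"
  shows "loopfree_digraph (incomparability_graph V r)"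
  using partial_order_onD(1)[OF assms]
  by unfold_locales (auto simp: incomparability_graph_def refl_on_def)


section \<open>Distance, diameter and isometric paths\<close>

text \<open>The infimum of the empty set is \<open>\<infinity>\<close>, so vertices not joined by a path are at
  distance \<open>\<infinity>\<close>; a one-vertex path has length 0.\<close>

definition graph_dist :: "('a, 'b) pre_digraph \<Rightarrow> 'a \<Rightarrow> 'a \<Rightarrow> enat" where
  "graph_dist G x y = (INF p\<in>{p. vpath p G \<and> hd p = x \<and> last p = y}. enat (vwalk_length p))"

definition graph_diameter :: "('a, 'b) pre_digraph \<Rightarrow> enat" where
  "graph_diameter G = (SUP x\<in>verts G. SUP y\<in>verts G. graph_dist G x y)"

definition infinite_isometric_path :: "('a, 'b) pre_digraph \<Rightarrow> (nat \<Rightarrow> 'a) \<Rightarrow> bool" where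
  "infinite_isometric_path G x \<longleftrightarrow>
     (\<forall>i. x i \<in> verts G) \<and>
     (\<forall>i j. graph_dist G (x i) (x j) = enat (nat \<bar>int i - int j\<bar>))"

end

theory Submission
  imports Defs
begin

text \<open>Interval orders contain no \<open>2 + 2\<close>. Hence for every vertex \<open>v\<close> the neighbours
  of \<open>v\<close> that have a neighbour above \<open>v\<close> form an antichain, and likewise for those
  that have a neighbour below \<open>v\<close>. So only finitely many neighbours of \<open>v\<close> can
  follow \<open>v\<close> on a geodesic that extends at least two steps beyond \<open>v\<close>, although
  \<open>v\<close> may have infinite degree. Since there are geodesics of every length from a fixed vertex,
  Koenig's lemma yields an infinite one.\<close>

section \<open>Distances in digraphs\<close>

lemma length_vwalk_to_vpath_le: "length (vwalk_to_vpath p) \<le> length p"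
proof (induction p rule: vwalk_to_vpath.induct)
  case (2 x xs)
  show ?case
  proof (cases "x \<in> set xs")
    case True
    have "length (dropWhile (\<lambda>y. y \<noteq> x) xs) \<le> length xs"
      by (rule length_dropWhile_le)
    with 2(1)[OF True] True show ?thesis by simp
  qed (use 2(2) in simp)
qed simp

text \<open>Distances are infima over paths, but walks are easier to join, reverse and cut. Removing
  the repetitions of a walk keeps its ends and never lengthens it, so every walk bounds the
  distance.\<close>

lemma graph_dist_le_vwalk_length:
  assumes "vwalk p G"
  shows "graph_dist G (hd p) (last p) \<le> enat (length p - 1)"
proof -
  let ?q = "vwalk_to_vpath p"
  have "graph_dist G (hd p) (last p) \<le> enat (vwalk_length ?q)"
    unfolding graph_dist_def
    by (rule INF_lower)
      (simp add: vwalk_to_vpath_vpath[OF assms] vwalk_to_vpath_hd vwalk_to_vpath_last)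
  also have "\<dots> \<le> enat (length p - 1)"
    using length_vwalk_to_vpath_le[of p] by simp
  finally show ?thesis .
qed

text \<open>Only an empty infimum is \<infinity> here, and a nonempty set in \<open>enat\<close>
  contains its infimum. A walk with n arcs lists \<open>Suc n\<close> vertices.\<close>

lemma graph_dist_eq_enatE:
  assumes "graph_dist G x y = enat n"
  obtains p where "vwalk p G" "hd p = x" "last p = y" "length p = Suc n"
proof -
  let ?A = "(\<lambda>p. enat (vwalk_length p)) ` {p. vpath p G \<and> hd p = x \<and> last p = y}"
  have "?A \<noteq> {}"
    using assms by (force simp: graph_dist_def top_enat_def)
  then have "Inf ?A \<in> ?A"
    unfolding Inf_enat_def by (auto intro: LeastI)
  then obtain p where p: "vpath p G" "hd p = x" "last p = y" "enat (vwalk_length p) = enat n"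
    using assms by (auto simp: graph_dist_def)
  then have "vwalk p G" "p \<noteq> []" by (auto simp: vpath_def)
  with p that[of p] show thesis by (cases p) auto
qed

lemma graph_dist_self:
  assumes "x \<in> verts G"
  shows "graph_dist G x x = 0"
  using graph_dist_le_vwalk_length[of "[x]" G] assms by (simp add: zero_enat_def[symmetric])

lemma graph_dist_triangle: "graph_dist G x z \<le> graph_dist G x y + graph_dist G y z"
proof (cases "graph_dist G x y")
  case (enat m)
  show ?thesis
  proof (cases "graph_dist G y z")
    case n: (enat n)
    obtain p where p: "vwalk p G" "hd p = x" "last p = y" "length p = Suc m"
      using graph_dist_eq_enatE[OF enat] .
    obtain q where q: "vwalk q G" "hd q = y" "last q = z" "length q = Suc n"
      using graph_dist_eq_enatE[OF n] .
    have j: "joinable p q" using p q by (auto simp: joinable_def)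
    \<comment> \<open>The join keeps a single copy of the shared vertex y, so its arcs number m +
      n.\<close>
    have "graph_dist G (hd (p \<oplus> q)) (last (p \<oplus> q)) \<le> enat (length (p \<oplus> q) - 1)"
      by (intro graph_dist_le_vwalk_length vwalk_joinI_vwalk p q j)
    then show ?thesis
      using p q j enat n by (simp add: vwalk_join_hd vwalk_join_last) (simp add: vwalk_join_def)
  qed simp
qed simp

lemma graph_dist_commute_le:
  assumes "symmetric G"
  shows "graph_dist G y x \<le> graph_dist G x y"
proof (cases "graph_dist G x y")
  case (enat n)
  then obtain p where p: "vwalk p G" "hd p = x" "last p = y" "length p = Suc n"
    by (rule graph_dist_eq_enatE)
  then have "p \<noteq> []" by auto
  then show ?thesis
    using graph_dist_le_vwalk_length[OF vwalk_rev_ex[OF assms p(1)]] p enat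
    by (simp add: hd_rev last_rev)
qed simp

lemma graph_dist_commute:
  assumes "symmetric G"
  shows "graph_dist G x y = graph_dist G y x"
  by (rule antisym) (rule graph_dist_commute_le[OF assms])+

lemma graph_dist_1_imp_dominates:
  assumes "graph_dist G x y = 1"
  shows "x \<rightarrow>\<^bsub>G\<^esub> y"
proof -
  obtain p where p: "vwalk p G" "hd p = x" "last p = y" "length p = Suc 1"
    using assms graph_dist_eq_enatE[of G x y 1] by (auto simp: one_enat_def)
  then have "p = [x, y]"
    by (cases p; cases "tl p") auto
  with p(1) show ?thesis by (auto simp: vwalk_def)
qed

lemma (in wf_digraph) dominates_imp_graph_dist_le_1:
  assumes "x \<rightarrow> y"
  shows "graph_dist G x y \<le> 1"
  using graph_dist_le_vwalk_length[of "[x, y]" G] adj_in_verts[OF assms] assms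
  by (simp add: one_enat_def)

lemma (in wf_digraph) reachable_imp_graph_dist_finite:
  assumes "x \<rightarrow>\<^sup>* y"
  shows "graph_dist G x y \<noteq> \<infinity>"
proof -
  obtain p where "vwalk p G" "hd p = x" "last p = y"
    using assms by (auto simp: reachable_vwalk_conv)
  then show ?thesis
    using graph_dist_le_vwalk_length[of p G] by (metis enat_ord_simps(5) infinity_ileE)
qed

lemma graph_dist_nth_le:
  assumes "vwalk p G" "i \<le> j" "j < length p"
  shows "graph_dist G (p ! i) (p ! j) \<le> enat (j - i)"
proof -
  let ?q = "take (Suc (j - i)) (drop i p)"
  have "vwalk (drop i p) G"
    by (rule vwalkI_append_r[where p = "take i p"]) (use assms in auto)
  then have "vwalk (?q @ drop (Suc (j - i)) (drop i p)) G"
    by (simp only: append_take_drop_id)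
  then have "vwalk ?q G"
    by (rule vwalkI_append_l[rotated]) (use assms in simp)
  moreover have "hd ?q = p ! i" "last ?q = p ! j" "length ?q - 1 = j - i"
    using assms by (auto simp: hd_drop_conv_nth last_conv_nth)
  ultimately show ?thesis
    using graph_dist_le_vwalk_length[of ?q G] by simp
qed

text \<open>Shortest walks are geodesic between any two of their positions, since a shortcut inside
  would shorten the whole. Nothing is claimed about \<open>g\<close> beyond position n.\<close>

lemma ex_geodesic:
  assumes "graph_dist G a x = enat n"
  shows "\<exists>g. g 0 = a \<and> g n = x \<and>
           (\<forall>i j. i \<le> j \<and> j \<le> n \<longrightarrow> graph_dist G (g i) (g j) = enat (j - i))"
proof -
  obtain p where p: "vwalk p G" "hd p = a" "last p = x" "length p = Suc n"
    using assms by (rule graph_dist_eq_enatE)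
  then have ends: "p ! 0 = a" "p ! n = x"
    by (auto simp: hd_conv_nth last_conv_nth simp flip: length_greater_0_conv)
  have "graph_dist G (p ! i) (p ! j) = enat (j - i)" if ij: "i \<le> j" "j \<le> n" for i j
  proof -
    have le: "graph_dist G (p ! i) (p ! j) \<le> enat (j - i)"
      using p ij by (intro graph_dist_nth_le) auto
    then obtain d where d: "graph_dist G (p ! i) (p ! j) = enat d"
      by (metis enat_ile)
    \<comment> \<open>The walk is cut at i and j. The outer pieces cost at most i and n - j, which
      leaves at least j - i for the middle one.\<close>
    have "enat n \<le> graph_dist G (p ! 0) (p ! i) + graph_dist G (p ! i) (p ! n)"
      using assms ends graph_dist_triangle[of G "p ! 0" "p ! n" "p ! i"] by simp
    also have "\<dots> \<le> graph_dist G (p ! 0) (p ! i) +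
        (graph_dist G (p ! i) (p ! j) + graph_dist G (p ! j) (p ! n))"
      by (intro add_left_mono graph_dist_triangle)
    also have "\<dots> \<le> enat (i - 0) + (enat d + enat (n - j))"
      using p ij d by (intro add_mono graph_dist_nth_le) auto
    finally show ?thesis
      using d le ij by simp
  qed
  with ends show ?thesis by blast
qed

section \<open>Compactness\<close>

text \<open>Koenig's lemma for the tree of prefixes of the sequences \<open>g n\<close>: since each
  coordinate takes finitely many values, repeated pigeonholing finds a branch \<open>x\<close> each
  of whose prefixes is shared by infinitely many of them.\<close>

lemma koenig_sequences:
  fixes g :: "nat \<Rightarrow> nat \<Rightarrow> 'b"
  assumes "\<And>k. finite (range (\<lambda>n. g n k))"
  shows "\<exists>x. \<forall>k. infinite {n. \<forall>i<k. g n i = x i}"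
proof -
  \<comment> \<open>Passing from \<open>A k\<close> to \<open>A (Suc k)\<close> freezes coordinate
    k. As the sets decrease, all indices in \<open>A k\<close> agree on every coordinate below
    k.\<close>
  have "\<exists>A. \<forall>k. infinite (A k) \<and> (A (Suc k) \<subseteq> A k \<and> (\<exists>c. \<forall>n\<in>A (Suc k). g n k = c))"
  proof (rule dependent_nat_choice)
    show "\<exists>A :: nat set. infinite A" by blast
  next
    fix A :: "nat set" and k
    assume A: "infinite A"
    have "finite ((\<lambda>n. g n k) ` A)"
      by (rule finite_subset[OF _ assms[of k]]) auto
    then obtain n where "n \<in> A" "infinite {m \<in> A. g m k = g n k}"
      using pigeonhole_infinite[OF A] by blast
    then show "\<exists>B. infinite B \<and> (B \<subseteq> A \<and> (\<exists>c. \<forall>n\<in>B. g n k = c))"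
      by (intro exI[of _ "{m \<in> A. g m k = g n k}"]) auto
  qed
  then obtain A where A: "\<And>k. infinite (A k)" "\<And>k. A (Suc k) \<subseteq> A k"
      "\<And>k. \<exists>c. \<forall>n\<in>A (Suc k). g n k = c"
    by blast
  from A(3) obtain x where x: "\<And>k n. n \<in> A (Suc k) \<Longrightarrow> g n k = x k"
    by metis
  have "A k \<subseteq> {n. \<forall>i<k. g n i = x i}" for k
  proof clarify
    fix n i assume "n \<in> A k" "i < k"
    then have "n \<in> A (Suc i)"
      using lift_Suc_antimono_le[of A "Suc i" k, OF A(2)] by auto
    then show "g n i = x i" by (rule x)
  qed
  with A(1) have "infinite {n. \<forall>i<k. g n i = x i}" for k
    by (metis finite_subset)
  then show ?thesis by blast
qed

section \<open>Infinite geodesics\<close>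

text \<open>The last hypothesis replaces local finiteness: it counts only the midpoints of geodesics
  of length two from \<open>v\<close>. This suffices to show by induction on k that the geodesics
  \<open>g n\<close> visit finitely many vertices at position k.\<close>

lemma ex_infinite_isometric_path:
  assumes sym: "symmetric G" and a: "a \<in> verts G"
    and unbounded: "\<And>n. \<exists>x m. graph_dist G a x = enat m \<and> n \<le> m"
    and fin: "\<And>v. finite {y. graph_dist G v y = 1 \<and>
                              (\<exists>z. graph_dist G y z = 1 \<and> graph_dist G v z = 2)}"
  shows "\<exists>x. infinite_isometric_path G x"
proof -
  have "\<exists>g. g 0 = a \<and>
          (\<forall>i j. i \<le> j \<and> j \<le> n \<longrightarrow> graph_dist G (g i) (g j) = enat (j - i))" for n
  proof -
    obtain x m where "graph_dist G a x = enat m" "n \<le> m"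
      using unbounded by blast
    then show ?thesis
      using ex_geodesic[of G a x m] by (meson order_trans)
  qed
  then obtain g where g0: "\<And>n. g n 0 = a"
    and g: "\<And>n i j. i \<le> j \<Longrightarrow> j \<le> n \<Longrightarrow> graph_dist G (g n i) (g n j) = enat (j - i)"
    by metis
  have "finite (range (\<lambda>n. g n k))" for k
  proof (induction k)
    case 0
    then show ?case by (simp add: g0)
  next
    case (Suc k)
    define N where "N v = {y. graph_dist G v y = 1 \<and>
      (\<exists>z. graph_dist G y z = 1 \<and> graph_dist G v z = 2)}" for v
    \<comment> \<open>The bound on n keeps position k + 2 on the geodesic, where it supplies the
      witness z. The finitely many smaller n are added separately below.\<close>
    have step: "g n (Suc k) \<in> (\<Union>v\<in>range (\<lambda>n. g n k). N v)" if "k + 2 \<le> n" for n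
    proof -
      have "g n (Suc k) \<in> N (g n k)"
        unfolding N_def
        using g[of k "Suc k" n] g[of "Suc k" "k + 2" n] g[of k "k + 2" n] that
        by (auto simp: one_enat_def numeral_eq_enat)
      then show ?thesis by blast
    qed
    have "range (\<lambda>n. g n (Suc k)) \<subseteq>
        (\<lambda>n. g n (Suc k)) ` {..<k + 2} \<union> (\<Union>v\<in>range (\<lambda>n. g n k). N v)"
    proof (rule image_subsetI)
      fix n
      show "g n (Suc k) \<in> (\<lambda>n. g n (Suc k)) ` {..<k + 2} \<union> (\<Union>v\<in>range (\<lambda>n. g n k). N v)"
        using step[of n] by (cases "n < k + 2") (auto simp: not_less)
    qed
    moreover have "finite ((\<lambda>n. g n (Suc k)) ` {..<k + 2} \<union> (\<Union>v\<in>range (\<lambda>n. g n k). N v))"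
      unfolding N_def by (intro finite_UnI finite_imageI finite_lessThan finite_UN_I Suc fin)
    ultimately show ?case
      by (rule finite_subset)
  qed
  from koenig_sequences[of g, OF this] obtain x
    where x: "\<And>k. infinite {n. \<forall>i<k. g n i = x i}" by blast
  have dist: "graph_dist G (x i) (x j) = enat (j - i)" if "i \<le> j" for i j
  proof -
    \<comment> \<open>Infinitely many \<open>g n\<close> agree with \<open>x\<close> through
      position j. One with n at least j is geodesic that far.\<close>
    obtain n where "n \<ge> j" "\<forall>i<Suc j. g n i = x i"
      using x[of "Suc j"] unfolding infinite_nat_iff_unbounded_le by blast
    then show ?thesis
      using g[of i j n] that by simp
  qed
  have "x i \<in> verts G" for i
  proof -
    obtain p where "vwalk p G" "hd p = x i"
      using graph_dist_eq_enatE[OF dist[of i i]] by auto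
    then show ?thesis by (metis hd_in_set vwalkE subsetD)
  qed
  moreover have "graph_dist G (x i) (x j) = enat (nat \<bar>int i - int j\<bar>)" for i j
  proof (cases "i \<le> j")
    case True
    then have "nat \<bar>int i - int j\<bar> = j - i" by linarith
    with dist[OF True] show ?thesis by simp
  next
    case False
    then have "j \<le> i" "nat \<bar>int i - int j\<bar> = i - j" by linarith+
    with dist[of j i] show ?thesis by (simp add: graph_dist_commute[OF sym, of "x i"])
  qed
  ultimately show ?thesis
    unfolding infinite_isometric_path_def by blast
qed

text \<open>This moves unboundedness from pairs to the base point: if all vertices were within n of
  \<open>a\<close>, detours through \<open>a\<close> would bound the diameter by 2n.\<close>

lemma unbounded_graph_dist:
  assumes sym: "symmetric G" and a: "a \<in> verts G"
    and fin: "\<And>x. x \<in> verts G \<Longrightarrow> graph_dist G a x \<noteq> \<infinity>"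
    and diam: "graph_diameter G = \<infinity>"
  shows "\<exists>x m. graph_dist G a x = enat m \<and> n \<le> m"
proof (rule ccontr)
  assume neg: "\<not> ?thesis"
  have bd: "graph_dist G a x \<le> enat n" if "x \<in> verts G" for x
    using neg fin[OF that] by (cases "graph_dist G a x") (auto simp: not_le intro: less_imp_le)
  have "graph_dist G x y \<le> enat (n + n)" if "x \<in> verts G" "y \<in> verts G" for x y
  proof -
    have "graph_dist G x y \<le> graph_dist G a x + graph_dist G a y"
      using graph_dist_triangle[of G x y a] graph_dist_commute[OF sym, of x a] by simp
    also have "\<dots> \<le> enat n + enat n"
      by (intro add_mono bd that)
    finally show ?thesis by simp
  qed
  then have "graph_diameter G \<le> enat (n + n)"
    unfolding graph_diameter_def by (intro SUP_least)
  with diam show False by simp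
qed

section \<open>Interval orders\<close>

text \<open>If both conclusions failed, the intervals would contain points x of \<open>h a\<close>,
  v of \<open>h b\<close>, u of \<open>h c\<close> and y of \<open>h d\<close> with x < v \<le> u
  \<le> y \<le> x.\<close>

lemma interval_order_2_plus_2_free:
  assumes "interval_order TYPE('c) V r"
    and ab: "a \<in> V" "b \<in> V" "(a, b) \<in> r" "a \<noteq> b"
    and cd: "c \<in> V" "d \<in> V" "(c, d) \<in> r" "c \<noteq> d"
  shows "(a, d) \<in> r \<or> (c, b) \<in> r"
proof (rule ccontr)
  assume neg: "\<not> ?thesis"
  from assms(1) obtain C :: "'c set" and s \<J> h where lin: "linear_order_on C s"
    and \<J>: "\<forall>I\<in>\<J>. I \<noteq> {} \<and> interval_of_chain C s I"
    and iso: "order_isomorphism V r \<J> (interval_le_rel s \<J>) h"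
    unfolding interval_order_def by blast
  have h: "h x \<in> \<J>" "h x \<subseteq> C" if "x \<in> V" for x
    using iso \<J> that
    by (auto simp: order_isomorphism_def bij_betw_def interval_of_chain_def)
  have inj: "h x \<noteq> h y" if "x \<in> V" "y \<in> V" "x \<noteq> y" for x y
    using iso that by (auto simp: order_isomorphism_def bij_betw_def inj_on_def)
  have rel: "(x, y) \<in> r \<longleftrightarrow> h x = h y \<or> interval_less s (h x) (h y)"
    if "x \<in> V" "y \<in> V" for x y
    using iso h that by (auto simp: order_isomorphism_def interval_le_rel_def)
  have trans: "\<And>x y z. (x, y) \<in> s \<Longrightarrow> (y, z) \<in> s \<Longrightarrow> (x, z) \<in> s"
    and antisym: "\<And>x y. (x, y) \<in> s \<Longrightarrow> (y, x) \<in> s \<Longrightarrow> x = y"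
    and total: "\<And>x y. x \<in> C \<Longrightarrow> y \<in> C \<Longrightarrow> (x, y) \<in> s \<or> (y, x) \<in> s"
    using lin unfolding linear_order_on_def partial_order_on_def preorder_on_def
    by (auto dest: transD antisymD simp: total_on_def refl_on_def) metis
  have less: "interval_less s (h a) (h b)" "interval_less s (h c) (h d)"
    using rel inj ab cd by blast+
  \<comment> \<open>Since the chain is total, a failure of \<open>interval_less\<close> yields two
    points in the weakly reversed order, possibly equal.\<close>
  have reversed: "\<exists>x\<in>h p. \<exists>y\<in>h q. (y, x) \<in> s" if "p \<in> V" "q \<in> V" "(p, q) \<notin> r" for p q
  proof -
    have "\<not> interval_less s (h p) (h q)"
      using rel that by blast
    then obtain x y where xy: "x \<in> h p" "y \<in> h q" "(x, y) \<notin> s \<or> x = y"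
      unfolding interval_less_def by blast
    moreover have "x \<in> C" "y \<in> C"
      using xy h(2) that by blast+
    ultimately show ?thesis
      using total[of y x] total[of x x] by blast
  qed
  obtain x y where xy: "x \<in> h a" "y \<in> h d" "(y, x) \<in> s"
    using reversed[of a d] neg ab cd by blast
  obtain u v where uv: "u \<in> h c" "v \<in> h b" "(v, u) \<in> s"
    using reversed[of c b] neg ab cd by blast
  have "(x, v) \<in> s" "x \<noteq> v" "(u, y) \<in> s"
    using less xy uv unfolding interval_less_def by blast+
  then show False
    using xy uv trans antisym by metis
qed

text \<open>A vertex z distinct from and not adjacent to \<open>v\<close> is comparable to it, so
  the set splits into \<open>?U\<close> (z above \<open>v\<close>) and \<open>?D\<close> (z below
  \<open>v\<close>), both antichains.\<close>

lemma finite_two_step_neighbours: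
  fixes V :: "'a set" and r :: "'a rel"
  defines "E \<equiv> \<lambda>x y. x \<rightarrow>\<^bsub>incomparability_graph V r\<^esub> y"
  assumes int: "interval_order TYPE('c) V r"
    and fac: "\<forall>A. antichain_of V r A \<longrightarrow> finite A"
  shows "finite {y. E v y \<and> (\<exists>z. E y z \<and> z \<noteq> v \<and> \<not> E v z)}" (is "finite ?N")
proof -
  have E: "E x y \<longleftrightarrow> x \<in> V \<and> y \<in> V \<and> (x, y) \<notin> r \<and> (y, x) \<notin> r" for x y
    unfolding E_def by (rule dominates_incomparability_graph_iff)
  let ?U = "{y. E v y \<and> (\<exists>z. E y z \<and> z \<noteq> v \<and> (v, z) \<in> r)}"
  let ?D = "{y. E v y \<and> (\<exists>z. E y z \<and> z \<noteq> v \<and> (z, v) \<in> r)}"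
  have "antichain_of V r ?U"
    unfolding antichain_of_def
  proof (intro conjI ballI impI)
    show "?U \<subseteq> V" by (auto simp: E)
  next
    fix y y' assume "y \<in> ?U" "y' \<in> ?U" "y \<noteq> y'"
    then show "(y, y') \<notin> r"
      \<comment> \<open>With z the witness of y, the pairs y < y' and v < z would force y < z or v <
        y', against incomparability.\<close>
      using interval_order_2_plus_2_free[OF int, of y y' v] by (auto simp: E)
  qed
  moreover have "antichain_of V r ?D"
    unfolding antichain_of_def
  proof (intro conjI ballI impI)
    show "?D \<subseteq> V" by (auto simp: E)
  next
    fix y y' assume "y \<in> ?D" "y' \<in> ?D" "y \<noteq> y'"
    then show "(y, y') \<notin> r"
      \<comment> \<open>Dually, z is now the witness of y', and z < v together with y < y' would
        force y < v or z < y'.\<close>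
      using interval_order_2_plus_2_free[OF int, of y y' _ v] by (auto simp: E)
  qed
  ultimately have "finite (?U \<union> ?D)"
    using fac by blast
  moreover have "?N \<subseteq> ?U \<union> ?D"
    by (auto simp: E)
  ultimately show ?thesis
    by (rule finite_subset[rotated])
qed

theorem theorem6:
  fixes V :: "'a set" and r :: "'a rel"
  assumes "interval_order TYPE('c) V r"
    and "\<forall>A. antichain_of V r A \<longrightarrow> finite A"
    and "Digraph_Component.connected (incomparability_graph V r)"
    and "graph_diameter (incomparability_graph V r) = \<infinity>"
  shows "\<exists>x. infinite_isometric_path (incomparability_graph V r) x"
proof -
  define G where "G = incomparability_graph V r"
  interpret G: sym_digraph G
    unfolding G_def by (rule sym_digraph_incomparability_graph)
  have sc: "strongly_connected G"
    using G.symmetric_connected_imp_strongly_connected[OF G.sym_arcs] assms(3)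
    by (simp add: G_def)
  then obtain a where a: "a \<in> verts G"
    by (auto simp: strongly_connected_def)
  have "finite {y. graph_dist G v y = 1 \<and>
          (\<exists>z. graph_dist G y z = 1 \<and> graph_dist G v z = 2)}" for v
  proof (rule finite_subset)
    show "finite {y. v \<rightarrow>\<^bsub>G\<^esub> y \<and> (\<exists>z. y \<rightarrow>\<^bsub>G\<^esub> z \<and> z \<noteq> v \<and> \<not> v \<rightarrow>\<^bsub>G\<^esub> z)}"
      unfolding G_def by (rule finite_two_step_neighbours[OF assms(1,2)])
    \<comment> \<open>Distance 2 excludes z = v, at distance 0, and adjacency, at distance at most
      1.\<close>
    have "z \<noteq> v \<and> \<not> v \<rightarrow>\<^bsub>G\<^esub> z" if "v \<rightarrow>\<^bsub>G\<^esub> y" "graph_dist G v z = 2" for y z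
      using graph_dist_self[of v G] G.dominates_imp_graph_dist_le_1[of v z]
        G.adj_in_verts[OF that(1)] that(2) by auto
    then show "{y. graph_dist G v y = 1 \<and>
          (\<exists>z. graph_dist G y z = 1 \<and> graph_dist G v z = 2)}
        \<subseteq> {y. v \<rightarrow>\<^bsub>G\<^esub> y \<and> (\<exists>z. y \<rightarrow>\<^bsub>G\<^esub> z \<and> z \<noteq> v \<and> \<not> v \<rightarrow>\<^bsub>G\<^esub> z)}"
      using graph_dist_1_imp_dominates[of G] by blast
  qed
  moreover have "\<exists>x m. graph_dist G a x = enat m \<and> n \<le> m" for n
  proof (rule unbounded_graph_dist[OF G.sym_arcs a])
    show "graph_dist G a x \<noteq> \<infinity>" if "x \<in> verts G" for x
      using sc a that by (intro G.reachable_imp_graph_dist_finite) auto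
    show "graph_diameter G = \<infinity>"
      using assms(4) by (simp add: G_def)
  qed
  ultimately show ?thesis
    using ex_infinite_isometric_path[OF G.sym_arcs a] unfolding G_def by blast
qed

end
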